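(* Consider the fully discrete Backward Euler scheme: given $(w^h_n,p^h_n)\in(X^h,Q^h)$, find $(w^h_{n+1},p^h_{n+1})\in(X^h,Q^h)$ satisfying $$\Big(\frac{w^h_{n+1}-w^h_n}{k},v^h\Big)+\frac{C_s^4\delta^2}{\mu^2}\Big(\frac{\nabla w^h_{n+1}-\nabla w^h_n}{k},\nabla v^h\Big)+b^*(w^h_n,w^h_{n+1},v^h)+\nu(\nabla w^h_{n+1},\nabla v^h)$$ $$+(C_s\delta)^2\big(|\nabla w^h_n|\nabla w^h_{n+1},\nabla v^h\big)+\gamma(\nabla\cdot w^h_{n+1},\nabla\cdot v^h)-(p^h_{n+1},\nabla\cdot v^h)=(f_{n+1},v^h)\quad\forall v^h\in X^h,$$ $$(\nabla\cdot w^h_{n+1},q^h)=0\quad\forall q^h\in Q^h .$$ This method is unconditionally energy stable: for any $N\ge1$ (and any time step $k>0$), $$\Big(\frac12\|w^h_N\|^2+\frac12\frac{C_s^4\delta^2}{\mu^2}\|\nabla w^h_N\|^2\Big)+\sum_{n=0}^{N-1}\frac12\Big(\|w^h_{n+1}-w^h_n\|^2+\frac{C_s^4\delta^2}{\mu^2}\|\nabla w^h_{n+1}-\nabla w^h_n\|^2\Big)$$ $$+k\sum_{n=0}^{N-1}\Big\{\int_\Omega\big[\nu+(C_s\delta)^2|\nabla w^h_n|\big]|\nabla w^h_{n+1}|^2\,dx+\gamma\|\nabla\cdot w^h_{n+1}\|^2\Big\}$$ $$=\Big(\frac12\|w^h_0\|^2+\frac12\frac{C_s^4\delta^2}{\mu^2}\|\nabla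 w^h_0\|^2\Big)+k\sum_{n=0}^{N-1}(f_{n+1},w^h_{n+1}).$$
   Context: $\Omega\subset\mathbb{R}^d$ ($d=2$ or $3$) is a regular bounded flow domain. $\nu>0$, $C_s,\delta,\mu>0$ and $\gamma$ (grad-div stabilization parameter) are constants. $\|\cdot\|$ and $(\cdot,\cdot)$ are the $L^2(\Omega)$ norm and inner product. $|\nabla w|$ is the Euclidean (Frobenius) norm of the velocity gradient. $X=\{v\in L^3(\Omega):\nabla v\in L^3(\Omega),\ v=0\text{ on }\partial\Omega\}$ (vector fields), $Q=\{q\in L^2(\Omega):\int_\Omega q\,dx=0\}$; $X^h\subset X$, $Q^h\subset Q$ are finite element spaces satisfying the discrete inf-sup condition $\inf_{\lambda^h\in Q^h}\sup_{v^h\in X^h}\frac{(\lambda^h,\nabla\cdot v^h)}{\|\lambda^h\|\|\nabla v^h\|}\ge\beta^h>0$ with $\beta^h$ bounded away from zero uniformly in $h$. Trilinear form: $b^*(u,v,w)=\frac12(u\cdot\nabla v,w)-\frac12(u\cdot\nabla w,v)$. $k>0$ is the time step, $t_n=nk$, $f_n(x)=f(x,t_n)$ for the prescribed body force $f$, and $w^h_n$, $p^h_n$ approximate the velocity and pressure of the Corrected Smagorinsky Model at time $t_n$. *)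

theory Defs
  imports "HOL-Analysis.Analysis"
begin

text \<open>The boundary is locally the graph of a Lipschitz function over the hyperplane orthogonal to
  a unit vector \<open>e\<close>, with the domain strictly on the side of \<open>e\<close>.\<close>

definition lipschitz_boundary :: "(real ^ 'd) set \<Rightarrow> bool" where
  "lipschitz_boundary \<Omega> \<longleftrightarrow>
    (\<forall>z\<in>frontier \<Omega>. \<exists>e r L. \<exists>g :: real ^ 'd \<Rightarrow> real.
        norm e = 1 \<and> r > 0 \<and> L-lipschitz_on UNIV g \<and>
        \<Omega> \<inter> ball z r = {y \<in> ball z r. g (y - (y \<bullet> e) *\<^sub>R e) < y \<bullet> e})"

definition flow_domain :: "(real ^ 'd) set \<Rightarrow> bool" where
  "flow_domain \<Omega> \<longleftrightarrow>
    open \<Omega> \<and> connected \<Omega> \<and> \<Omega> \<noteq> {} \<and> bounded \<Omega> \<and> lipschitz_boundary \<Omega>"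


text \<open>Elements of the function spaces below are represented by functions on the whole space; only
  their values almost everywhere on \<open>\<Omega>\<close> matter.\<close>

definition Lp :: "(real ^ 'd) set \<Rightarrow> nat \<Rightarrow> (real ^ 'd \<Rightarrow> 'b::euclidean_space) set" where
  "Lp \<Omega> p = {f. f \<in> borel_measurable (lebesgue_on \<Omega>) \<and>
                integrable (lebesgue_on \<Omega>) (\<lambda>x. norm (f x) ^ p)}"

text \<open>On \<open>real ^ 'd ^ 'd\<close> the library's inner product and norm are the Frobenius ones.\<close>

definition L2_inner ::
    "(real ^ 'd) set \<Rightarrow> (real ^ 'd \<Rightarrow> 'b::euclidean_space) \<Rightarrow> (real ^ 'd \<Rightarrow> 'b) \<Rightarrow> real" where
  "L2_inner \<Omega> f g = (LINT x|lebesgue_on \<Omega>. f x \<bullet> g x)"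

definition L2_norm :: "(real ^ 'd) set \<Rightarrow> (real ^ 'd \<Rightarrow> 'b::euclidean_space) \<Rightarrow> real" where
  "L2_norm \<Omega> f = sqrt (L2_inner \<Omega> f f)"


abbreviation partial_deriv ::
    "(real ^ 'd \<Rightarrow> 'b::euclidean_space) \<Rightarrow> 'd \<Rightarrow> real ^ 'd \<Rightarrow> 'b" where
  "partial_deriv f j x \<equiv> frechet_derivative f (at x) (axis j 1)"

primrec C_k :: "nat \<Rightarrow> (real ^ 'd \<Rightarrow> 'b::euclidean_space) \<Rightarrow> bool" where
  "C_k 0 f \<longleftrightarrow> continuous_on UNIV f"
| "C_k (Suc m) f \<longleftrightarrow> (\<forall>x. f differentiable (at x)) \<and> (\<forall>j. C_k m (partial_deriv f j))"

definition test_function :: "(real ^ 'd) set \<Rightarrow> (real ^ 'd \<Rightarrow> 'b::euclidean_space) \<Rightarrow> bool" where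
  "test_function \<Omega> \<phi> \<longleftrightarrow>
    (\<forall>m. C_k m \<phi>) \<and> compact (closure {x. \<phi> x \<noteq> 0}) \<and> closure {x. \<phi> x \<noteq> 0} \<subseteq> \<Omega>"

definition locally_integrable ::
    "(real ^ 'd) set \<Rightarrow> (real ^ 'd \<Rightarrow> 'b::euclidean_space) \<Rightarrow> bool" where
  "locally_integrable \<Omega> f \<longleftrightarrow> (\<forall>K. compact K \<and> K \<subseteq> \<Omega> \<longrightarrow> f absolutely_integrable_on K)"

text \<open>Row \<open>i\<close> of the gradient is the gradient of component \<open>i\<close>.\<close>

definition has_weak_grad ::
    "(real ^ 'd) set \<Rightarrow> (real ^ 'd \<Rightarrow> real ^ 'd) \<Rightarrow> (real ^ 'd \<Rightarrow> real ^ 'd ^ 'd) \<Rightarrow> bool" where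
  "has_weak_grad \<Omega> v G \<longleftrightarrow> locally_integrable \<Omega> v \<and> locally_integrable \<Omega> G \<and>
    (\<forall>\<phi> :: real ^ 'd \<Rightarrow> real. test_function \<Omega> \<phi> \<longrightarrow>
      (\<forall>i j. (LINT x|lebesgue_on \<Omega>. v x $ i * partial_deriv \<phi> j x)
              = - (LINT x|lebesgue_on \<Omega>. G x $ i $ j * \<phi> x)))"

text \<open>Meaningful only if \<open>v\<close> is weakly differentiable; then it is determined up to a null set.\<close>

definition grad :: "(real ^ 'd) set \<Rightarrow> (real ^ 'd \<Rightarrow> real ^ 'd) \<Rightarrow> real ^ 'd \<Rightarrow> real ^ 'd ^ 'd" where
  "grad \<Omega> v = (SOME G. has_weak_grad \<Omega> v G)"

definition divg :: "(real ^ 'd) set \<Rightarrow> (real ^ 'd \<Rightarrow> real ^ 'd) \<Rightarrow> real ^ 'd \<Rightarrow> real" where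
  "divg \<Omega> v x = trace (grad \<Omega> v x)"

text \<open>The condition \<open>v = 0\<close> on the boundary is understood in the usual Sobolev sense: \<open>v\<close> is a
  \<open>W\<^sup>1\<^sup>,\<^sup>3\<close>-limit of test functions.\<close>

definition zero_on_boundary :: "(real ^ 'd) set \<Rightarrow> (real ^ 'd \<Rightarrow> real ^ 'd) \<Rightarrow> bool" where
  "zero_on_boundary \<Omega> v \<longleftrightarrow>
    (\<exists>\<phi> :: nat \<Rightarrow> real ^ 'd \<Rightarrow> real ^ 'd. (\<forall>m. test_function \<Omega> (\<phi> m)) \<and>
      (\<lambda>m. LINT x|lebesgue_on \<Omega>. norm (v x - \<phi> m x) ^ 3) \<longlonglongrightarrow> 0 \<and>
      (\<lambda>m. LINT x|lebesgue_on \<Omega>.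
              norm (grad \<Omega> v x - jacobian (\<phi> m) (at x)) ^ 3) \<longlonglongrightarrow> 0)"

definition velocity_space :: "(real ^ 'd) set \<Rightarrow> (real ^ 'd \<Rightarrow> real ^ 'd) set" where
  "velocity_space \<Omega> =
    {v. v \<in> Lp \<Omega> 3 \<and> has_weak_grad \<Omega> v (grad \<Omega> v) \<and> grad \<Omega> v \<in> Lp \<Omega> 3 \<and> zero_on_boundary \<Omega> v}"

definition pressure_space :: "(real ^ 'd) set \<Rightarrow> (real ^ 'd \<Rightarrow> real) set" where
  "pressure_space \<Omega> = {q. q \<in> Lp \<Omega> 2 \<and> (LINT x|lebesgue_on \<Omega>. q x) = 0}"


text \<open>Conforming finite element spaces enter only as finite-dimensional subspaces, that is, spans of
  finitely many shape functions.\<close>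

definition finite_dim_subspace ::
    "(real ^ 'd \<Rightarrow> 'b::euclidean_space) set \<Rightarrow> (real ^ 'd \<Rightarrow> 'b) set \<Rightarrow> bool" where
  "finite_dim_subspace V W \<longleftrightarrow> V \<subseteq> W \<and>
    (\<exists>m. \<exists>b :: nat \<Rightarrow> real ^ 'd \<Rightarrow> 'b. V = {v. \<exists>c :: nat \<Rightarrow> real. v = (\<lambda>x. \<Sum>i<m. c i *\<^sub>R b i x)})"

text \<open>The infimum and supremum range over nonzero elements. They are taken in \<open>ereal\<close>, where a
  supremum over the empty set is \<open>-\<infinity>\<close>.\<close>

definition inf_sup_condition ::
    "(real ^ 'd) set \<Rightarrow> (real ^ 'd \<Rightarrow> real ^ 'd) set \<Rightarrow> (real ^ 'd \<Rightarrow> real) set \<Rightarrow> real \<Rightarrow> bool" where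
  "inf_sup_condition \<Omega> Xh Qh \<beta> \<longleftrightarrow>
    (INF q\<in>{q\<in>Qh. L2_norm \<Omega> q \<noteq> 0}. SUP v\<in>{v\<in>Xh. L2_norm \<Omega> (grad \<Omega> v) \<noteq> 0}.
        ereal (L2_inner \<Omega> q (divg \<Omega> v) / (L2_norm \<Omega> q * L2_norm \<Omega> (grad \<Omega> v)))) \<ge> ereal \<beta>"


definition convect ::
    "(real ^ 'd) set \<Rightarrow> (real ^ 'd \<Rightarrow> real ^ 'd) \<Rightarrow> (real ^ 'd \<Rightarrow> real ^ 'd) \<Rightarrow> real ^ 'd \<Rightarrow> real ^ 'd" where
  "convect \<Omega> u v x = grad \<Omega> v x *v u x"

definition b_star :: "(real ^ 'd) set \<Rightarrow> (real ^ 'd \<Rightarrow> real ^ 'd) \<Rightarrow> (real ^ 'd \<Rightarrow> real ^ 'd)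
    \<Rightarrow> (real ^ 'd \<Rightarrow> real ^ 'd) \<Rightarrow> real" where
  "b_star \<Omega> u v w = 1/2 * L2_inner \<Omega> (convect \<Omega> u v) w - 1/2 * L2_inner \<Omega> (convect \<Omega> u w) v"

text \<open>One time step from \<open>w\<close> to \<open>(w', p')\<close> with body force \<open>F\<close> at the new time level.\<close>

definition backward_euler_step ::
    "(real ^ 'd) set \<Rightarrow> real \<Rightarrow> real \<Rightarrow> real \<Rightarrow> real \<Rightarrow> real \<Rightarrow> real
      \<Rightarrow> (real ^ 'd \<Rightarrow> real ^ 'd) set \<Rightarrow> (real ^ 'd \<Rightarrow> real) set
      \<Rightarrow> (real ^ 'd \<Rightarrow> real ^ 'd) \<Rightarrow> (real ^ 'd \<Rightarrow> real ^ 'd)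
      \<Rightarrow> (real ^ 'd \<Rightarrow> real ^ 'd) \<Rightarrow> (real ^ 'd \<Rightarrow> real) \<Rightarrow> bool" where
  "backward_euler_step \<Omega> \<nu> C\<^sub>s \<delta> \<mu> \<gamma> k Xh Qh F w w' p' \<longleftrightarrow>
    (\<forall>v\<in>Xh.
        L2_inner \<Omega> (\<lambda>x. (1/k) *\<^sub>R (w' x - w x)) v
      + C\<^sub>s^4 * \<delta>^2 / \<mu>^2 * L2_inner \<Omega> (\<lambda>x. (1/k) *\<^sub>R (grad \<Omega> w' x - grad \<Omega> w x)) (grad \<Omega> v)
      + b_star \<Omega> w w' v
      + \<nu> * L2_inner \<Omega> (grad \<Omega> w') (grad \<Omega> v)
      + (C\<^sub>s * \<delta>)^2 * L2_inner \<Omega> (\<lambda>x. norm (grad \<Omega> w x) *\<^sub>R grad \<Omega> w' x) (grad \<Omega> v)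
      + \<gamma> * L2_inner \<Omega> (divg \<Omega> w') (divg \<Omega> v)
      - L2_inner \<Omega> p' (divg \<Omega> v)
      = L2_inner \<Omega> F v) \<and>
    (\<forall>q\<in>Qh. L2_inner \<Omega> (divg \<Omega> w') q = 0)"

end

theory Submission
  imports Defs
begin

text \<open>
  The energy balance comes from testing each time step with the new velocity \<open>w\<^sub>n\<^sub>+\<^sub>1\<close> itself,
  which is admissible because it lies in the finite element space. Then

  \<^item> the convective term vanishes: \<open>b\<^sup>*(u, v, v)\<close> is the difference of two equal numbers,
    which is why the trilinear form is skew-symmetrised;
  \<^item> the pressure term vanishes: the new pressure is an admissible test function in the discrete
    continuity equation;
  \<^item> each of the two difference quotients \<open>(a - b, a)/k\<close> splits, by the polarisation identity
    \<open>(a - b, a) = (\<parallel>a\<parallel>\<^sup>2 - \<parallel>b\<parallel>\<^sup>2 + \<parallel>a - b\<parallel>\<^sup>2)/2\<close>, into an increment of energy and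
    a numerical dissipation;
  \<^item> the two viscous terms merge into one integral with the viscosity
    \<open>\<nu> + (C\<^sub>s \<delta>)\<^sup>2 \<bar>\<nabla>w\<^sub>n\<bar>\<close>.

  Summing over the time steps, the energy increments telescope. The remaining point is that every
  integral that is split or merged on the way converges. This is where \<open>L\<^sup>3\<close>-regularity of
  velocity and gradient enters: on a bounded domain \<open>L\<^sup>3\<close> is contained in \<open>L\<^sup>2\<close>
  (lemma \<open>Lp_3_subset_Lp_2\<close>), and the Smagorinsky term is a product of three \<open>L\<^sup>3\<close> functions
  (lemma \<open>integrable_norm_mult_norm_power2\<close>).
\<close>

section \<open>Integrability\<close>

lemma Lp_3_subset_Lp_2:
  fixes \<Omega> :: "(real ^ 'd) set"
  assumes "open \<Omega>" "bounded \<Omega>"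
  shows "Lp \<Omega> 3 \<subseteq> (Lp \<Omega> 2 :: (real ^ 'd \<Rightarrow> 'b::euclidean_space) set)"
proof
  fix f :: "real ^ 'd \<Rightarrow> 'b"
  assume f: "f \<in> Lp \<Omega> 3"
  have [measurable]: "f \<in> borel_measurable (lebesgue_on \<Omega>)"
    using f by (simp add: Lp_def)
  interpret finite_measure "lebesgue_on \<Omega>"
    using assms by (intro finite_measure_lebesgue_on) (simp add: bounded_set_imp_lmeasurable)
  have bound: "t ^ 2 \<le> 1 + t ^ 3" if "t \<ge> 0" for t :: real
  proof (cases "t \<le> 1")
    case True
    have "t ^ 2 \<le> 1" using True that by (simp add: power_le_one)
    then show ?thesis using zero_le_power[OF that, of 3] by linarith
  next
    case False
    then have "t ^ 2 \<le> t ^ 3" by (intro power_increasing) auto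
    then show ?thesis by simp
  qed
  have "integrable (lebesgue_on \<Omega>) (\<lambda>x. norm (f x) ^ 2)"
  proof (rule Bochner_Integration.integrable_bound)
    show "integrable (lebesgue_on \<Omega>) (\<lambda>x. 1 + norm (f x) ^ 3)"
      using f by (simp add: Lp_def)
    show "AE x in lebesgue_on \<Omega>. norm (norm (f x) ^ 2) \<le> norm (1 + norm (f x) ^ 3)"
      using bound by (intro AE_I2) (simp add: abs_of_nonneg)
  qed measurable
  then show "f \<in> Lp \<Omega> 2"
    by (simp add: Lp_def)
qed

lemma integrable_inner_Lp_2:
  assumes "f \<in> Lp \<Omega> 2" "g \<in> Lp \<Omega> 2"
  shows "integrable (lebesgue_on \<Omega>) (\<lambda>x. f x \<bullet> g x)"
proof (rule Bochner_Integration.integrable_bound)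
  have [measurable]: "f \<in> borel_measurable (lebesgue_on \<Omega>)" "g \<in> borel_measurable (lebesgue_on \<Omega>)"
    using assms by (simp_all add: Lp_def)
  show "(\<lambda>x. f x \<bullet> g x) \<in> borel_measurable (lebesgue_on \<Omega>)"
    by measurable
  show "integrable (lebesgue_on \<Omega>) (\<lambda>x. norm (f x) ^ 2 + norm (g x) ^ 2)"
    using assms by (simp add: Lp_def)
  have "\<bar>f x \<bullet> g x\<bar> \<le> norm (f x) ^ 2 + norm (g x) ^ 2" for x
  proof -
    have "2 * (norm (f x) * norm (g x)) \<le> norm (f x) ^ 2 + norm (g x) ^ 2"
      using sum_squares_bound[of "norm (f x)" "norm (g x)"] by simp
    moreover have "\<bar>f x \<bullet> g x\<bar> \<le> norm (f x) * norm (g x)"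
      by (rule Cauchy_Schwarz_ineq2)
    moreover have "0 \<le> norm (f x) * norm (g x)"
      by simp
    ultimately show ?thesis by linarith
  qed
  then show "AE x in lebesgue_on \<Omega>. norm (f x \<bullet> g x) \<le> norm (norm (f x) ^ 2 + norm (g x) ^ 2)"
    by (intro AE_I2) simp
qed

text \<open>The product is dominated by the larger of the two cubes.\<close>

lemma integrable_norm_mult_norm_power2:
  assumes "f \<in> Lp \<Omega> 3" "g \<in> Lp \<Omega> 3"
  shows "integrable (lebesgue_on \<Omega>) (\<lambda>x. norm (f x) * norm (g x) ^ 2)"
proof (rule Bochner_Integration.integrable_bound)
  have [measurable]: "f \<in> borel_measurable (lebesgue_on \<Omega>)" "g \<in> borel_measurable (lebesgue_on \<Omega>)"
    using assms by (simp_all add: Lp_def)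
  show "(\<lambda>x. norm (f x) * norm (g x) ^ 2) \<in> borel_measurable (lebesgue_on \<Omega>)"
    by measurable
  show "integrable (lebesgue_on \<Omega>) (\<lambda>x. norm (f x) ^ 3 + norm (g x) ^ 3)"
    using assms by (simp add: Lp_def)
  have "s * t ^ 2 \<le> s ^ 3 + t ^ 3" if "s \<ge> 0" "t \<ge> 0" for s t :: real
  proof (cases "s \<le> t")
    case True
    then have "s * t ^ 2 \<le> t * t ^ 2" by (intro mult_right_mono) auto
    then show ?thesis using zero_le_power[OF that(1), of 3] by (simp add: power3_eq_cube power2_eq_square)
  next
    case False
    then have "s * t ^ 2 \<le> s * s ^ 2" using that by (intro mult_left_mono power_mono) auto
    then show ?thesis using zero_le_power[OF that(2), of 3] by (simp add: power3_eq_cube power2_eq_square)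
  qed
  then show "AE x in lebesgue_on \<Omega>.
      norm (norm (f x) * norm (g x) ^ 2) \<le> norm (norm (f x) ^ 3 + norm (g x) ^ 3)"
    by (intro AE_I2) (simp add: abs_of_nonneg)
qed

section \<open>The \<open>L\<^sup>2\<close> inner product\<close>

lemma L2_norm_power2: "(L2_norm \<Omega> f)^2 = L2_inner \<Omega> f f"
  by (simp add: L2_norm_def L2_inner_def)

lemma L2_inner_commute: "L2_inner \<Omega> f g = L2_inner \<Omega> g f"
  by (simp add: L2_inner_def inner_commute)

lemma L2_inner_scaleR_left: "L2_inner \<Omega> (\<lambda>x. c *\<^sub>R f x) g = c * L2_inner \<Omega> f g"
  by (simp add: L2_inner_def)

lemma L2_inner_diff_self:
  assumes "f \<in> Lp \<Omega> 2" "g \<in> Lp \<Omega> 2"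
  shows "L2_inner \<Omega> (\<lambda>x. f x - g x) f
    = 1/2 * ((L2_norm \<Omega> f)^2 - (L2_norm \<Omega> g)^2 + (L2_norm \<Omega> (\<lambda>x. f x - g x))^2)"
proof -
  note [simp] = integrable_inner_Lp_2[OF assms(1,1)] integrable_inner_Lp_2[OF assms(2,2)]
    integrable_inner_Lp_2[OF assms] integrable_inner_Lp_2[OF assms(2,1)]
  have "L2_inner \<Omega> (\<lambda>x. f x - g x) f = L2_inner \<Omega> f f - L2_inner \<Omega> g f"
    by (simp add: L2_inner_def inner_diff_left)
  moreover have "L2_inner \<Omega> (\<lambda>x. f x - g x) (\<lambda>x. f x - g x)
      = L2_inner \<Omega> f f - L2_inner \<Omega> g f - (L2_inner \<Omega> f g - L2_inner \<Omega> g g)"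
    by (simp add: L2_inner_def inner_diff_left inner_diff_right)
  ultimately show ?thesis
    by (simp add: L2_norm_power2 L2_inner_commute[of \<Omega> f g])
qed

section \<open>The energy balance\<close>

lemma b_star_self: "b_star \<Omega> u v v = 0"
  by (simp add: b_star_def)

lemma viscous_terms_merge:
  assumes "open \<Omega>" "bounded \<Omega>" "H \<in> Lp \<Omega> 3" "G \<in> Lp \<Omega> 3"
  shows "\<nu> * L2_inner \<Omega> G G + c * L2_inner \<Omega> (\<lambda>x. norm (H x) *\<^sub>R G x) G
    = (LINT x|lebesgue_on \<Omega>. (\<nu> + c * norm (H x)) * (norm (G x))^2)"
proof -
  have "G \<in> Lp \<Omega> 2"
    using Lp_3_subset_Lp_2[OF assms(1,2)] assms(4) by blast
  then have [simp]: "integrable (lebesgue_on \<Omega>) (\<lambda>x. (norm (G x))^2)"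
    by (simp add: Lp_def)
  note [simp] = integrable_norm_mult_norm_power2[OF assms(3,4)]
  have "(LINT x|lebesgue_on \<Omega>. (\<nu> + c * norm (H x)) * (norm (G x))^2)
      = (LINT x|lebesgue_on \<Omega>. \<nu> * (norm (G x))^2 + c * (norm (H x) * (norm (G x))^2))"
    by (simp add: algebra_simps)
  then show ?thesis
    by (simp add: L2_inner_def dot_square_norm)
qed

text \<open>Testing with \<open>w'\<close>, scaled by \<open>k\<close>: the polarised difference quotients give the first two
  terms, and the convective and pressure terms drop out.\<close>

lemma backward_euler_step_energy:
  fixes \<Omega> :: "(real ^ 'd) set"
  assumes dom: "open \<Omega>" "bounded \<Omega>"
    and X: "w \<in> velocity_space \<Omega>" "w' \<in> velocity_space \<Omega>"
    and test: "w' \<in> Xh" "p' \<in> Qh"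
    and "k \<noteq> 0"
    and step: "backward_euler_step \<Omega> \<nu> C\<^sub>s \<delta> \<mu> \<gamma> k Xh Qh F w w' p'"
  shows "1/2 * ((L2_norm \<Omega> w')^2 - (L2_norm \<Omega> w)^2 + (L2_norm \<Omega> (\<lambda>x. w' x - w x))^2)
      + C\<^sub>s^4 * \<delta>^2 / \<mu>^2 * (1/2 * ((L2_norm \<Omega> (grad \<Omega> w'))^2 - (L2_norm \<Omega> (grad \<Omega> w))^2
          + (L2_norm \<Omega> (\<lambda>x. grad \<Omega> w' x - grad \<Omega> w x))^2))
      + k * ((LINT x|lebesgue_on \<Omega>. (\<nu> + (C\<^sub>s * \<delta>)^2 * norm (grad \<Omega> w x)) * (norm (grad \<Omega> w' x))^2)
          + \<gamma> * (L2_norm \<Omega> (divg \<Omega> w'))^2)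
      = k * L2_inner \<Omega> F w'"
proof -
  have L3: "w \<in> Lp \<Omega> 3" "w' \<in> Lp \<Omega> 3" "grad \<Omega> w \<in> Lp \<Omega> 3" "grad \<Omega> w' \<in> Lp \<Omega> 3"
    using X by (auto simp: velocity_space_def)
  then have L2: "w \<in> Lp \<Omega> 2" "w' \<in> Lp \<Omega> 2" "grad \<Omega> w \<in> Lp \<Omega> 2" "grad \<Omega> w' \<in> Lp \<Omega> 2"
    using Lp_3_subset_Lp_2[OF dom] by blast+
  define A where "A = L2_inner \<Omega> (\<lambda>x. w' x - w x) w'"
  define B where "B = L2_inner \<Omega> (\<lambda>x. grad \<Omega> w' x - grad \<Omega> w x) (grad \<Omega> w')"
  define V where "V = (LINT x|lebesgue_on \<Omega>.
    (\<nu> + (C\<^sub>s * \<delta>)^2 * norm (grad \<Omega> w x)) * (norm (grad \<Omega> w' x))^2)"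
  have pressure: "L2_inner \<Omega> p' (divg \<Omega> w') = 0"
    using step test L2_inner_commute[of \<Omega> p'] by (simp add: backward_euler_step_def)
  have V: "V = \<nu> * L2_inner \<Omega> (grad \<Omega> w') (grad \<Omega> w')
      + (C\<^sub>s * \<delta>)^2 * L2_inner \<Omega> (\<lambda>x. norm (grad \<Omega> w x) *\<^sub>R grad \<Omega> w' x) (grad \<Omega> w')"
    unfolding V_def by (rule viscous_terms_merge[OF dom L3(3,4), symmetric])
  have "L2_inner \<Omega> (\<lambda>x. (1/k) *\<^sub>R (w' x - w x)) w'
      + C\<^sub>s^4 * \<delta>^2 / \<mu>^2 * L2_inner \<Omega> (\<lambda>x. (1/k) *\<^sub>R (grad \<Omega> w' x - grad \<Omega> w x)) (grad \<Omega> w')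
      + b_star \<Omega> w w' w'
      + \<nu> * L2_inner \<Omega> (grad \<Omega> w') (grad \<Omega> w')
      + (C\<^sub>s * \<delta>)^2 * L2_inner \<Omega> (\<lambda>x. norm (grad \<Omega> w x) *\<^sub>R grad \<Omega> w' x) (grad \<Omega> w')
      + \<gamma> * L2_inner \<Omega> (divg \<Omega> w') (divg \<Omega> w')
      - L2_inner \<Omega> p' (divg \<Omega> w')
      = L2_inner \<Omega> F w'"
    using step test unfolding backward_euler_step_def by blast
  then have "1/k * A + C\<^sub>s^4 * \<delta>^2 / \<mu>^2 * (1/k * B) + V + \<gamma> * (L2_norm \<Omega> (divg \<Omega> w'))^2
      = L2_inner \<Omega> F w'"
    unfolding L2_inner_scaleR_left A_def[symmetric] B_def[symmetric] b_star_self pressure V L2_norm_power2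
    by linarith
  then have "k * (1/k * A + C\<^sub>s^4 * \<delta>^2 / \<mu>^2 * (1/k * B) + V + \<gamma> * (L2_norm \<Omega> (divg \<Omega> w'))^2)
      = k * L2_inner \<Omega> F w'"
    by simp
  moreover have "k * (1/k * A + c * (1/k * B) + V + D) = A + c * B + k * (V + D)" for c D
    using \<open>k \<noteq> 0\<close> by (simp add: distrib_left)
  ultimately have "A + C\<^sub>s^4 * \<delta>^2 / \<mu>^2 * B + k * (V + \<gamma> * (L2_norm \<Omega> (divg \<Omega> w'))^2)
      = k * L2_inner \<Omega> F w'"
    by metis
  then show ?thesis
    unfolding A_def B_def L2_inner_diff_self[OF L2(2,1)] L2_inner_diff_self[OF L2(4,3)] V_def .
qed

text \<open>Here \<open>a\<close> and \<open>b\<close> stand for the squared norms of velocity and gradient, \<open>da\<close> and \<open>db\<close> for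
  those of their increments, \<open>V\<close> for the dissipation and \<open>W\<close> for the work of the body force; the
  changes of the energy \<open>1/2 a + 1/2 c b\<close> telescope.\<close>

lemma energy_balance_telescope:
  fixes a b da db V W :: "nat \<Rightarrow> real"
  assumes "\<And>n. n < N \<Longrightarrow>
    1/2 * (a (Suc n) - a n + da n) + c * (1/2 * (b (Suc n) - b n + db n)) + k * V n = k * W n"
  shows "(1/2 * a N + 1/2 * c * b N) + (\<Sum>n<N. 1/2 * (da n + c * db n)) + k * (\<Sum>n<N. V n)
    = (1/2 * a 0 + 1/2 * c * b 0) + k * (\<Sum>n<N. W n)"
  using assms
proof (induction N)
  case 0
  then show ?case by simp
next
  case (Suc N)
  have "(1/2 * a N + 1/2 * c * b N) + (\<Sum>n<N. 1/2 * (da n + c * db n)) + k * (\<Sum>n<N. V n)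
      = (1/2 * a 0 + 1/2 * c * b 0) + k * (\<Sum>n<N. W n)"
    using Suc by simp
  with Suc.prems[of N] show ?case
    by (simp add: algebra_simps add_divide_distrib diff_divide_distrib)
qed

theorem theorem5p4:
  fixes \<Omega> :: "(real ^ 'd) set"
    and \<nu> C\<^sub>s \<delta> \<mu> \<gamma> k h \<beta>\<^sub>0 :: real
    and mesh_sizes :: "real set"
    and X\<^sub>h :: "real \<Rightarrow> (real ^ 'd \<Rightarrow> real ^ 'd) set"
    and Q\<^sub>h :: "real \<Rightarrow> (real ^ 'd \<Rightarrow> real) set"
    and \<beta> :: "real \<Rightarrow> real"
    and f :: "real \<Rightarrow> real ^ 'd \<Rightarrow> real ^ 'd"
    and w :: "nat \<Rightarrow> real ^ 'd \<Rightarrow> real ^ 'd"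
    and p :: "nat \<Rightarrow> real ^ 'd \<Rightarrow> real"
    and N :: nat
  assumes "CARD('d) = 2 \<or> CARD('d) = 3"
    and "flow_domain \<Omega>"
    and "\<nu> > 0" "C\<^sub>s > 0" "\<delta> > 0" "\<mu> > 0"
    and "mesh_sizes \<subseteq> {0<..}"
    and "\<And>h. h \<in> mesh_sizes \<Longrightarrow> finite_dim_subspace (X\<^sub>h h) (velocity_space \<Omega>)"
    and "\<And>h. h \<in> mesh_sizes \<Longrightarrow> finite_dim_subspace (Q\<^sub>h h) (pressure_space \<Omega>)"
    and "\<beta>\<^sub>0 > 0"
    and "\<And>h. h \<in> mesh_sizes \<Longrightarrow> \<beta> h \<ge> \<beta>\<^sub>0"
    and "\<And>h. h \<in> mesh_sizes \<Longrightarrow> inf_sup_condition \<Omega> (X\<^sub>h h) (Q\<^sub>h h) (\<beta> h)"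
    and "h \<in> mesh_sizes"
    and "k > 0"
    and "N \<ge> 1"
    and "\<And>n. n < N \<Longrightarrow> f (real (Suc n) * k) \<in> Lp \<Omega> 2"
    and "\<And>n. n \<le> N \<Longrightarrow> w n \<in> X\<^sub>h h"
    and "\<And>n. n \<le> N \<Longrightarrow> p n \<in> Q\<^sub>h h"
    and "\<And>n. n < N \<Longrightarrow>
          backward_euler_step \<Omega> \<nu> C\<^sub>s \<delta> \<mu> \<gamma> k (X\<^sub>h h) (Q\<^sub>h h)
            (f (real (Suc n) * k)) (w n) (w (Suc n)) (p (Suc n))"
  shows "(1/2 * (L2_norm \<Omega> (w N))^2
            + 1/2 * (C\<^sub>s^4 * \<delta>^2 / \<mu>^2) * (L2_norm \<Omega> (grad \<Omega> (w N)))^2)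
        + (\<Sum>n<N. 1/2 * ((L2_norm \<Omega> (\<lambda>x. w (Suc n) x - w n x))^2
            + C\<^sub>s^4 * \<delta>^2 / \<mu>^2
                * (L2_norm \<Omega> (\<lambda>x. grad \<Omega> (w (Suc n)) x - grad \<Omega> (w n) x))^2))
        + k * (\<Sum>n<N.
              (LINT x|lebesgue_on \<Omega>. (\<nu> + (C\<^sub>s * \<delta>)^2 * norm (grad \<Omega> (w n) x))
                                      * (norm (grad \<Omega> (w (Suc n)) x))^2)
            + \<gamma> * (L2_norm \<Omega> (divg \<Omega> (w (Suc n))))^2)
      = (1/2 * (L2_norm \<Omega> (w 0))^2
            + 1/2 * (C\<^sub>s^4 * \<delta>^2 / \<mu>^2) * (L2_norm \<Omega> (grad \<Omega> (w 0)))^2)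
        + k * (\<Sum>n<N. L2_inner \<Omega> (f (real (Suc n) * k)) (w (Suc n)))"
proof -
  have dom: "open \<Omega>" "bounded \<Omega>"
    using assms(2) by (auto simp: flow_domain_def)
  have Xh: "w n \<in> X\<^sub>h h" if "n \<le> N" for n
    using that by fact
  have Qh: "p n \<in> Q\<^sub>h h" if "n \<le> N" for n
    using that by fact
  have "X\<^sub>h h \<subseteq> velocity_space \<Omega>"
    using assms(8) \<open>h \<in> mesh_sizes\<close> by (auto simp: finite_dim_subspace_def)
  with Xh have X: "w n \<in> velocity_space \<Omega>" if "n \<le> N" for n
    using that by blast
  have step: "backward_euler_step \<Omega> \<nu> C\<^sub>s \<delta> \<mu> \<gamma> k (X\<^sub>h h) (Q\<^sub>h h)
      (f (real (Suc n) * k)) (w n) (w (Suc n)) (p (Suc n))" if "n < N" for n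
    using that by fact
  have "k \<noteq> 0"
    using \<open>k > 0\<close> by simp
  show ?thesis
    by (rule energy_balance_telescope, rule backward_euler_step_energy[OF dom _ _ _ _ \<open>k \<noteq> 0\<close> step])
      (simp_all add: X Xh Qh)
qed

end
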